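(* Schrijver's $\vartheta'$-function is not, in general, an upper bound on the Shannon capacity of a graph. Explicitly, let $G$ be the graph on $32$ vertices with vertex set $V(G)=\{0,1\}^5$ in which two vertices $u,v$ are adjacent if and only if $1\le d_{\mathrm H}(u,v)\le 2$, where $d_{\mathrm H}$ denotes the Hamming distance. Then $$\Theta(G)\;\ge\;\sqrt{\alpha(G\boxtimes G)}\;\ge\;\sqrt{20}\;>\;4\;=\;\vartheta'(G).$$ In particular, the inequality $\Theta(G)\le \vartheta'(G)$ fails for this graph.
   Context: All graphs are simple, finite, and undirected. $\alpha(G)$ denotes the independence number of $G$ (the maximum size of a set of pairwise non-adjacent vertices). Strong product: for graphs $G$ and $H$, $G\boxtimes H$ is the graph with vertex set $V(G)\times V(H)$, where distinct vertices $(g,h)$ and $(g',h')$ are adjacent if and only if one of the following holds: (1) $g=g'$ and $\{h,h'\}\in E(H)$; (2) $\{g,g'\}\in E(G)$ and $h=h'$; (3) $\{g,g'\}\in E(G)$ and $\{h,h'\}\in E(H)$. For $k\in\mathbb{N}$ (positive integers), $G^{\boxtimes k}=G\boxtimes\cdots\boxtimes G$ is the strong product of $k$ copies of $G$. Shannon capacity: $\Theta(G)=\sup_{k\in\mathbb{N}}\sqrt[k]{\alpha(G^{\boxtimes k})}$. Schrijver's $\vartheta'$-function: for a graph $G$ on $n$ vertices with adjacency matrix $A=(A_{i,j})$, $\vartheta'(G)$ is the optimal value of the semidefinite program: minimize $\lambda_{\max}(X)$ over all real symmetric $n\times n$ matrices $X$ such that $X_{i,j}\ge 1$ for all $i,j\in\{1,\ldots,n\}$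 with $A_{i,j}=0$ (including the diagonal entries $i=j$). Here $\lambda_{\max}(X)$ is the largest eigenvalue of $X$. *)

theory Defs
  imports
    "HOL-Analysis.Analysis"
    "Graph_Theory.Pair_Digraph"
    "Jordan_Normal_Form.Spectral_Radius"
begin

(* A finite simple undirected graph is a value satisfying the locale predicate pair_graph:
   finite vertex set pverts, and a symmetric, loop-free relation parcs on it.  An edge {u,v}
   is represented by the two arcs (u,v) and (v,u). *)

definition independent_set :: "'a pair_pre_digraph \<Rightarrow> 'a set \<Rightarrow> bool" where
  "independent_set G S \<longleftrightarrow> S \<subseteq> pverts G \<and> (\<forall>u\<in>S. \<forall>v\<in>S. (u, v) \<notin> parcs G)"

definition independence_number :: "'a pair_pre_digraph \<Rightarrow> nat" where
  "independence_number G = Max (card ` {S. independent_set G S})"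

definition strong_product ::
    "'a pair_pre_digraph \<Rightarrow> 'b pair_pre_digraph \<Rightarrow> ('a \<times> 'b) pair_pre_digraph"
    (infixr "\<boxtimes>" 75) where
  "G \<boxtimes> H = \<lparr> pverts = pverts G \<times> pverts H,
     parcs = {((g, h), (g', h')) | g h g' h'.
        (g, h) \<in> pverts G \<times> pverts H \<and> (g', h') \<in> pverts G \<times> pverts H \<and>
        (g, h) \<noteq> (g', h') \<and>
        (g = g' \<and> (h, h') \<in> parcs H \<or>
         (g, g') \<in> parcs G \<and> h = h' \<or>
         (g, g') \<in> parcs G \<and> (h, h') \<in> parcs H)} \<rparr>"

definition image_graph :: "('a \<Rightarrow> 'b) \<Rightarrow> 'a pair_pre_digraph \<Rightarrow> 'b pair_pre_digraph" where
  "image_graph f G = \<lparr> pverts = f ` pverts G, parcs = map_prod f f ` parcs G \<rparr>"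

(* To keep the vertex type independent of k, the tuple (g1, ..., gk) is encoded as the list
   [g1, ..., gk].  The 0-th power is the one-vertex graph, which is neutral for the strong
   product up to isomorphism; see strong_power_1 and strong_power_2. *)
primrec strong_power :: "'a pair_pre_digraph \<Rightarrow> nat \<Rightarrow> 'a list pair_pre_digraph" where
  "strong_power G 0 = \<lparr> pverts = {[]}, parcs = {} \<rparr>"
| "strong_power G (Suc k) = image_graph (\<lambda>(x, xs). x # xs) (G \<boxtimes> strong_power G k)"

(* The supremum is over a set bounded by card (pverts G). *)
definition shannon_capacity :: "'a pair_pre_digraph \<Rightarrow> real" where
  "shannon_capacity G = (SUP k\<in>{1..}. root k (real (independence_number (strong_power G k))))"

definition lambda_max :: "real mat \<Rightarrow> real" where
  "lambda_max X = Max (spectrum X)"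

definition adjacency_matrix :: "'a pair_pre_digraph \<Rightarrow> (nat \<Rightarrow> 'a) \<Rightarrow> real mat" where
  "adjacency_matrix G e = mat (card (pverts G)) (card (pverts G))
     (\<lambda>(i, j). if (e i, e j) \<in> parcs G then 1 else 0)"

definition theta'_feasible :: "real mat \<Rightarrow> real mat set" where
  "theta'_feasible A = {X. X \<in> carrier_mat (dim_row A) (dim_row A) \<and> transpose_mat X = X \<and>
     (\<forall>i < dim_row A. \<forall>j < dim_row A. A $$ (i, j) = 0 \<longrightarrow> X $$ (i, j) \<ge> 1)}"

(* For at least one vertex the infimum is that of a nonempty set bounded below, since a feasible X
   has trace at least n and hence lambda_max X >= 1.  Reordering the vertices permutes rows and
   columns of feasible matrices simultaneously, so the value does not depend on the enumeration e. *)
definition schrijver_theta' :: "'a pair_pre_digraph \<Rightarrow> real" where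
  "schrijver_theta' G =
     (let e = (SOME e. bij_betw e {..<card (pverts G)} (pverts G))
      in INF X\<in>theta'_feasible (adjacency_matrix G e). lambda_max X)"

(* Intended for lists of equal length. *)
definition hamming_dist :: "'a list \<Rightarrow> 'a list \<Rightarrow> nat" where
  "hamming_dist u v = card {i. i < length u \<and> u ! i \<noteq> v ! i}"

definition hamming_graph_5_2 :: "bool list pair_pre_digraph" where
  "hamming_graph_5_2 = \<lparr> pverts = {u. length u = 5},
     parcs = {(u, v). length u = 5 \<and> length v = 5 \<and>
                1 \<le> hamming_dist u v \<and> hamming_dist u v \<le> 2} \<rparr>"


lemma strong_power_1:
  assumes "pair_graph G"
  shows "strong_power G 1 = image_graph (\<lambda>x. [x]) G"
proof -
  interpret pair_graph G by fact
  have "(u, v) \<in> parcs (G \<boxtimes> strong_power G 0) \<longleftrightarrow>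
      snd u = [] \<and> snd v = [] \<and> (fst u, fst v) \<in> parcs G" for u v
    by (cases u; cases v)
      (auto simp: strong_product_def dest: in_arcsD1 in_arcsD2 pair_no_loops)
  then have "parcs (G \<boxtimes> strong_power G 0) = map_prod (\<lambda>x. (x, [])) (\<lambda>x. (x, [])) ` parcs G"
    by (force simp: set_eq_iff image_iff)
  moreover have "pverts (G \<boxtimes> strong_power G 0) = (\<lambda>x. (x, [])) ` pverts G"
    by (auto simp: strong_product_def)
  ultimately show ?thesis
    by (simp add: image_graph_def image_image prod.map_comp comp_def del: strong_power.simps(1))
qed

lemma strong_power_2:
  assumes "pair_graph G"
  shows "strong_power G 2 = image_graph (\<lambda>(x, y). [x, y]) (G \<boxtimes> G)"
proof -
  have prod: "G \<boxtimes> image_graph (\<lambda>x. [x]) G = image_graph (map_prod id (\<lambda>x. [x])) (G \<boxtimes> G)"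
    by (force simp: strong_product_def image_graph_def image_iff)
  have "strong_power G 2 = image_graph (\<lambda>(x, xs). x # xs) (G \<boxtimes> strong_power G 1)"
    by (simp add: numeral_2_eq_2)
  also have "\<dots> = image_graph (\<lambda>(x, y). [x, y]) (G \<boxtimes> G)"
    unfolding strong_power_1[OF assms] prod
    by (auto simp: image_graph_def image_image prod.map_comp comp_def case_prod_unfold)
  finally show ?thesis .
qed

end

theory Submission
  imports Defs
begin

text \<open>Evaluating the quadratic form of a feasible matrix at the indicator vector of an independent
  set \<open>S\<close> bounds its largest eigenvalue below by \<open>|S|\<close>; a binary code of length 5, distance 3 and
  size 4 gives \<open>\<vartheta>' \<ge> 4\<close>. The matching feasible matrix has entries
  \<open>4 \<delta>(u, v) - (5 - 2 d + (-1)^d) / 2\<close> with \<open>d = d(u, v)\<close>, i.e. \<open>1, -1, -1, 1, 1, 3\<close> for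
  \<open>d = 0, ..., 5\<close>. Since \<open>5 - 2 d + (-1)^d\<close> is the sum of the products \<open>\<chi>(u) \<chi>(v)\<close> over the six characters \<open>\<chi>\<close>
  of weight 1 and 5 on \<open>{0,1}^5\<close>, the matrix is \<open>4 I\<close> minus a positive semidefinite one.\<close>

section \<open>Quadratic forms and the largest eigenvalue of a symmetric matrix\<close>

definition quad_form :: "real mat \<Rightarrow> (nat \<Rightarrow> real) \<Rightarrow> real" where
  "quad_form X y = (\<Sum>i<dim_row X. \<Sum>j<dim_row X. X $$ (i, j) * y i * y j)"

text \<open>A continuous form attains its maximum on the compact unit sphere, and homogeneity of
  degree 2 carries the bound from the sphere to every \<open>y\<close>.\<close>

lemma quad_form_max_attained:
  assumes "dim_row X > 0"
  obtains x where "(\<Sum>i<dim_row X. (x i)\<^sup>2) = 1"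
    and "\<And>y. quad_form X y \<le> quad_form X x * (\<Sum>i<dim_row X. (y i)\<^sup>2)"
proof -
  define n where "n = dim_row X"
  \<comment> \<open>Vectors are functions on all of \<open>nat\<close>. Pinning the coordinates from
    \<open>n\<close> on to 0 makes \<open>K\<close> a product of compact sets, so Tychonoff's
    theorem applies, and \<open>S\<close> is a copy of the unit sphere in dimension
    \<open>n\<close>.\<close>
  define K :: "(nat \<Rightarrow> real) set" where "K = PiE UNIV (\<lambda>i. if i < n then {-1..1} else {0})"
  define S where "S = K \<inter> {x. (\<Sum>i<n. (x i)\<^sup>2) = 1}"
  have coord: "continuous_on UNIV (\<lambda>x :: nat \<Rightarrow> real. x i)" for i
    by (rule continuous_on_product_coordinates)
  have "compact K"
  proof -
    have "compactin (product_topology (\<lambda>i. euclidean) UNIV) K"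
      unfolding K_def by (subst compactin_PiE) auto
    then show ?thesis
      by (simp add: euclidean_product_topology)
  qed
  moreover have "closed {x. (\<Sum>i<n. (x i)\<^sup>2) = (1 :: real)}"
    by (intro closed_Collect_eq continuous_intros coord)
  ultimately have "compact S"
    unfolding S_def by (rule compact_Int_closed)
  moreover have "(\<lambda>i. if i = 0 then 1 else 0) \<in> S"
    using assms by (auto simp: S_def K_def n_def if_distrib[of "\<lambda>x. x\<^sup>2"] cong: if_cong)
  then have "S \<noteq> {}"
    by blast
  moreover have "continuous_on S (quad_form X)"
    unfolding quad_form_def
    by (intro continuous_intros continuous_on_subset[OF coord]) auto
  ultimately obtain x where x: "x \<in> S" "\<And>z. z \<in> S \<Longrightarrow> quad_form X z \<le> quad_form X x"
    using continuous_attains_sup[of S "quad_form X"] by blast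
  have "quad_form X y \<le> quad_form X x * (\<Sum>i<n. (y i)\<^sup>2)" for y
  proof (cases "(\<Sum>i<n. (y i)\<^sup>2) = 0")
    case True
    then have "\<forall>i<n. y i = 0"
      by (simp add: sum_nonneg_eq_0_iff)
    then show ?thesis
      using True by (simp add: quad_form_def n_def)
  next
    case False
    define N where "N = (\<Sum>i<n. (y i)\<^sup>2)"
    have N: "N > 0"
      unfolding N_def using False by (metis less_eq_real_def sum_nonneg zero_le_power2)
    \<comment> \<open>\<open>y\<close> scaled to norm 1 and cut off beyond \<open>n\<close>, so that
      it lands in \<open>S\<close>.\<close>
    define z where "z i = (if i < n then y i / sqrt N else 0)" for i
    have le: "(y i)\<^sup>2 \<le> N" if "i < n" for i
      unfolding N_def using that by (intro member_le_sum) auto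
    have "\<bar>y i\<bar> \<le> sqrt N" if "i < n" for i
      using le[OF that] real_le_rsqrt by fastforce
    then have "\<bar>z i\<bar> \<le> 1" if "i < n" for i
      using that N by (simp add: z_def)
    then have "z i \<in> (if i < n then {-1..1} else {0})" for i
      by (cases "i < n") (force simp: abs_le_iff, simp add: z_def)
    then have "z \<in> K"
      unfolding K_def by (simp add: PiE_UNIV_domain)
    moreover have "(\<Sum>i<n. (z i)\<^sup>2) = 1"
    proof -
      have "(\<Sum>i<n. (z i)\<^sup>2) = (\<Sum>i<n. (y i)\<^sup>2 / N)"
        using N by (intro sum.cong) (auto simp: z_def power_divide)
      also have "\<dots> = 1"
        using N by (simp add: N_def flip: sum_divide_distrib)
      finally show ?thesis .
    qed
    ultimately have "quad_form X z \<le> quad_form X x"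
      by (intro x) (simp add: S_def)
    moreover have "quad_form X z = quad_form X y / N"
    proof -
      have "quad_form X z = (\<Sum>i<n. \<Sum>j<n. X $$ (i, j) * y i * y j / N)"
        unfolding quad_form_def n_def[symmetric]
        using N by (intro sum.cong refl) (auto simp: z_def)
      then show ?thesis
        by (simp add: quad_form_def n_def sum_divide_distrib)
    qed
    ultimately show ?thesis
      using N by (simp add: N_def field_simps)
  qed
  moreover have "(\<Sum>i<n. (x i)\<^sup>2) = 1"
    using x by (simp add: S_def)
  ultimately show thesis
    using that n_def by blast
qed

text \<open>The polynomial vanishes at 0, so nonnegativity makes 0 a minimum and the derivative
  there, \<open>2 * b\<close>, is zero. This is the first-order condition for the maximiser of the
  quadratic form.\<close>

lemma nonneg_quadratic_linear_coeff:
  fixes b c :: real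
  assumes "\<And>t. 2 * b * t + c * t\<^sup>2 \<ge> 0"
  shows "b = 0"
proof (rule ccontr)
  assume b: "b \<noteq> 0"
  \<comment> \<open>Large enough for the linear term to outweigh the quadratic one at
    \<open>t = - b / d\<close>.\<close>
  define d where "d = \<bar>c\<bar> + 1"
  have d: "d > 0" "c < 2 * d"
    by (auto simp: d_def)
  have "2 * b * (- b / d) + c * (- b / d)\<^sup>2 = b\<^sup>2 * (c - 2 * d) / d\<^sup>2"
    using d by (simp add: field_simps power2_eq_square)
  also have "\<dots> < 0"
    using b d by (simp add: divide_less_0_iff mult_less_0_iff zero_less_mult_iff)
  finally show False
    using assms[of "- b / d"] by simp
qed

text \<open>A maximiser of the form on the unit sphere is an eigenvector, and its eigenvalue is the
  maximum. In particular the real spectrum is nonempty.\<close>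

lemma symmetric_mat_Rayleigh:
  assumes X: "X \<in> carrier_mat n n" "transpose_mat X = X" "n > 0"
  obtains l where "l \<in> spectrum X" "\<And>y. quad_form X y \<le> l * (\<Sum>i<n. (y i)\<^sup>2)"
proof -
  have dim: "dim_row X = n" "dim_col X = n"
    using X by auto
  obtain x where x1: "(\<Sum>i<n. (x i)\<^sup>2) = 1"
    and max: "\<And>y. quad_form X y \<le> quad_form X x * (\<Sum>i<n. (y i)\<^sup>2)"
    using quad_form_max_attained[of X] X(3) dim by metis
  define l where "l = quad_form X x"
  have sym: "X $$ (i, j) = X $$ (j, i)" if "i < n" "j < n" for i j
    using X(2) dim that by (metis index_transpose_mat(1))
  \<comment> \<open>First variation: \<open>x\<close> is moved by \<open>t\<close> along the
    \<open>k\<close>-th unit vector \<open>e\<close>. By maximality, \<open>l\<close> times the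
    squared norm of the moved vector minus its form value is nonnegative. The constant terms cancel
    because \<open>x\<close> has norm 1 and form value \<open>l\<close>, and the vanishing linear
    coefficient is the \<open>k\<close>-th eigenvector equation.\<close>
  have eq: "(\<Sum>j<n. X $$ (k, j) * x j) = l * x k" if k: "k < n" for k
  proof -
    define e where "e i = (if i = k then 1 else 0 :: real)" for i
    define s where "s = (\<Sum>j<n. X $$ (k, j) * x j)"
    have "2 * (l * x k - s) * t + (l - X $$ (k, k)) * t\<^sup>2 \<ge> 0" for t
    proof -
      have "quad_form X (\<lambda>i. x i + t * e i)
          = (\<Sum>i<n. \<Sum>j<n. X $$ (i, j) * x i * x j
              + t * (e i * (X $$ (i, j) * x j)) + t * (e j * (X $$ (i, j) * x i))
              + t\<^sup>2 * (e i * (e j * X $$ (i, j))))"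
        unfolding quad_form_def dim
        by (intro sum.cong refl) (simp add: algebra_simps power2_eq_square)
      also have "\<dots> = l + t * (\<Sum>i<n. e i * (\<Sum>j<n. X $$ (i, j) * x j))
              + t * (\<Sum>i<n. \<Sum>j<n. e j * (X $$ (i, j) * x i))
              + t\<^sup>2 * (\<Sum>i<n. e i * (\<Sum>j<n. e j * X $$ (i, j)))"
        by (simp add: sum.distrib sum_distrib_left l_def quad_form_def dim)
      also have "(\<Sum>i<n. e i * (\<Sum>j<n. X $$ (i, j) * x j)) = s"
        using k by (simp add: e_def s_def if_distrib[of "\<lambda>c. c * _"] cong: if_cong)
      also have "(\<Sum>i<n. \<Sum>j<n. e j * (X $$ (i, j) * x i)) = (\<Sum>i<n. X $$ (i, k) * x i)"
        using k by (simp add: e_def if_distrib[of "\<lambda>c. c * _"] cong: if_cong)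
      also have "\<dots> = s"
        unfolding s_def using k sym by (intro sum.cong) auto
      also have "(\<Sum>i<n. e i * (\<Sum>j<n. e j * X $$ (i, j))) = X $$ (k, k)"
        using k by (simp add: e_def if_distrib[of "\<lambda>c. c * _"] cong: if_cong)
      finally have q: "quad_form X (\<lambda>i. x i + t * e i) = l + 2 * t * s + t\<^sup>2 * X $$ (k, k)"
        by simp
      have "(\<Sum>i<n. (x i + t * e i)\<^sup>2) = (\<Sum>i<n. (x i)\<^sup>2 + 2 * t * (e i * x i) + t\<^sup>2 * (e i * e i))"
        by (intro sum.cong refl) (simp add: algebra_simps power2_eq_square)
      also have "\<dots> = 1 + 2 * t * (\<Sum>i<n. e i * x i) + t\<^sup>2 * (\<Sum>i<n. e i * e i)"
        by (simp add: sum.distrib sum_distrib_left x1)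
      also have "\<dots> = 1 + 2 * t * x k + t\<^sup>2"
        using k by (simp add: e_def if_distrib[of "\<lambda>c. c * _"] cong: if_cong)
      finally show ?thesis
        using max[of "\<lambda>i. x i + t * e i"] q by (simp add: l_def[symmetric] algebra_simps)
    qed
    then show ?thesis
      using nonneg_quadratic_linear_coeff[of "l * x k - s" "l - X $$ (k, k)"] unfolding s_def by fastforce
  qed
  have "eigenvector X (vec n x) l"
    unfolding eigenvector_def
  proof (intro conjI)
    show "vec n x \<noteq> 0\<^sub>v (dim_row X)"
    proof
      assume "vec n x = 0\<^sub>v (dim_row X)"
      then have "x i = 0" if "i < n" for i
        using that dim by (metis index_vec index_zero_vec(1))
      then show False
        using x1 by simp
    qed
    show "X *\<^sub>v vec n x = l \<cdot>\<^sub>v vec n x"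
      using eq dim by (intro eq_vecI) (auto simp: scalar_prod_def lessThan_atLeast0)
  qed (use dim in auto)
  then have "l \<in> spectrum X"
    by (auto simp: spectrum_def eigenvalue_def)
  with max show thesis
    using that l_def by blast
qed

lemma quad_form_le_lambda_max:
  assumes X: "X \<in> carrier_mat n n" "transpose_mat X = X" "n > 0"
  shows "quad_form X y \<le> lambda_max X * (\<Sum>i<n. (y i)\<^sup>2)"
proof -
  obtain l where l: "l \<in> spectrum X" "\<And>y. quad_form X y \<le> l * (\<Sum>i<n. (y i)\<^sup>2)"
    using symmetric_mat_Rayleigh[OF X] by blast
  have "l \<le> lambda_max X"
    unfolding lambda_max_def using l(1) card_finite_spectrum(1)[OF X(1)] by simp
  then have "l * (\<Sum>i<n. (y i)\<^sup>2) \<le> lambda_max X * (\<Sum>i<n. (y i)\<^sup>2)"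
    by (intro mult_right_mono sum_nonneg) auto
  with l(2)[of y] show ?thesis
    by linarith
qed

text \<open>At an eigenvector for \<open>lambda_max X\<close> the form equals
  \<open>lambda_max X\<close> times the squared norm, which is positive and can be
  cancelled.\<close>

lemma lambda_max_le:
  assumes X: "X \<in> carrier_mat n n" "transpose_mat X = X" "n > 0"
    and le: "\<And>y. quad_form X y \<le> c * (\<Sum>i<n. (y i)\<^sup>2)"
  shows "lambda_max X \<le> c"
proof -
  have dim: "dim_row X = n" "dim_col X = n"
    using X by auto
  \<comment> \<open>\<open>Max\<close> is a member of the spectrum only if the spectrum is
    nonempty.\<close>
  have "spectrum X \<noteq> {}"
    using symmetric_mat_Rayleigh[OF X] by blast
  then have "lambda_max X \<in> spectrum X"
    unfolding lambda_max_def using card_finite_spectrum(1)[OF X(1)] by (intro Max_in)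
  then obtain v where v: "v \<in> carrier_vec n" "v \<noteq> 0\<^sub>v n" "X *\<^sub>v v = lambda_max X \<cdot>\<^sub>v v"
    by (auto simp: spectrum_def eigenvalue_def eigenvector_def dim)
  define y where "y = vec_index v"
  have eq: "(\<Sum>j<n. X $$ (i, j) * y j) = lambda_max X * y i" if "i < n" for i
  proof -
    have "vec_index (X *\<^sub>v v) i = (\<Sum>j<n. X $$ (i, j) * y j)"
      using that dim v(1) by (simp add: scalar_prod_def y_def lessThan_atLeast0)
    then show ?thesis
      using v that by (simp add: y_def)
  qed
  have "quad_form X y = (\<Sum>i<n. y i * (\<Sum>j<n. X $$ (i, j) * y j))"
    unfolding quad_form_def dim sum_distrib_left by (intro sum.cong refl) simp
  also have "\<dots> = (\<Sum>i<n. lambda_max X * (y i)\<^sup>2)"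
    by (intro sum.cong refl) (simp add: eq power2_eq_square)
  also have "\<dots> = lambda_max X * (\<Sum>i<n. (y i)\<^sup>2)"
    by (simp only: sum_distrib_left)
  finally have "lambda_max X * (\<Sum>i<n. (y i)\<^sup>2) \<le> c * (\<Sum>i<n. (y i)\<^sup>2)"
    using le[of y] by simp
  moreover have "(\<Sum>i<n. (y i)\<^sup>2) > 0"
  proof -
    obtain i where "i < n" "y i \<noteq> 0"
      using v(1,2) unfolding y_def by (metis carrier_vecD eq_vecI index_zero_vec)
    then show ?thesis
      by (intro sum_pos2[of _ i]) auto
  qed
  ultimately show ?thesis
    by simp
qed

section \<open>Independence numbers, Shannon capacity and the bound by the largest
  eigenvalue\<close>

lemma finite_independent_sets:
  assumes "finite (pverts G)"
  shows "finite {S. independent_set G S}"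
  by (rule finite_subset[of _ "Pow (pverts G)"]) (use assms in \<open>auto simp: independent_set_def\<close>)

lemma card_le_independence_number:
  assumes "finite (pverts G)" "independent_set G S"
  shows "card S \<le> independence_number G"
  unfolding independence_number_def using assms finite_independent_sets[OF assms(1)]
  by (intro Max_ge) auto

lemma independence_number_le_card:
  assumes "finite (pverts G)"
  shows "independence_number G \<le> card (pverts G)"
proof -
  have "independent_set G {}"
    by (simp add: independent_set_def)
  then have ne: "card ` {S. independent_set G S} \<noteq> {}"
    by blast
  have fin: "finite (card ` {S. independent_set G S})"
    using finite_independent_sets[OF assms] by (rule finite_imageI)
  show ?thesis
    unfolding independence_number_def
    by (rule Max.boundedI[OF fin ne]) (auto simp: independent_set_def intro: card_mono[OF assms])
qed

lemma obtain_max_independent_set: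
  assumes "finite (pverts G)"
  obtains S where "independent_set G S" "card S = independence_number G"
proof -
  have "independent_set G {}"
    by (simp add: independent_set_def)
  then have "independence_number G \<in> card ` {S. independent_set G S}"
    unfolding independence_number_def using finite_independent_sets[OF assms]
    by (intro Max_in) auto
  then show thesis
    using that by auto
qed

text \<open>An arc between two image points comes from an arc of \<open>G\<close>. By
  \<open>wf\<close> its ends are vertices, so injectivity identifies them with the given preimages,
  and the image of an independent set stays independent.\<close>

lemma independence_number_image_graph_ge:
  assumes fin: "finite (pverts G)" and wf: "parcs G \<subseteq> pverts G \<times> pverts G"
    and f: "inj_on f (pverts G)"
  shows "independence_number G \<le> independence_number (image_graph f G)"
proof -
  obtain S where S: "independent_set G S" "card S = independence_number G"
    using obtain_max_independent_set[OF fin] .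
  have sub: "S \<subseteq> pverts G"
    using S(1) by (simp add: independent_set_def)
  have "(f u, f v) \<notin> map_prod f f ` parcs G" if uv: "u \<in> S" "v \<in> S" for u v
  proof
    assume "(f u, f v) \<in> map_prod f f ` parcs G"
    then obtain a b where ab: "(a, b) \<in> parcs G" "f u = f a" "f v = f b"
      by auto
    then have "a = u" "b = v"
      using f wf sub uv by (metis inj_onD mem_Sigma_iff subsetD)+
    with ab uv S(1) show False
      by (simp add: independent_set_def)
  qed
  with sub have "independent_set (image_graph f G) (f ` S)"
    by (auto simp: independent_set_def image_graph_def)
  moreover have "finite (pverts (image_graph f G))"
    using fin by (simp add: image_graph_def)
  moreover have "card (f ` S) = card S"
    using f sub by (meson card_image inj_on_subset)
  ultimately show ?thesis
    using card_le_independence_number S(2) by metis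
qed

text \<open>The growth bound that keeps the roots in the Shannon capacity bounded by
  \<open>card (pverts G)\<close>.\<close>

lemma strong_power_verts:
  assumes "finite (pverts G)"
  shows "finite (pverts (strong_power G k)) \<and> card (pverts (strong_power G k)) \<le> card (pverts G) ^ k"
proof (induction k)
  case (Suc k)
  let ?P = "pverts G \<times> pverts (strong_power G k)"
  have eq: "pverts (strong_power G (Suc k)) = (\<lambda>(x, xs). x # xs) ` ?P"
    by (simp add: image_graph_def strong_product_def)
  have fin: "finite ?P"
    using assms Suc by simp
  have "card (pverts (strong_power G (Suc k))) \<le> card ?P"
    unfolding eq by (rule card_image_le[OF fin])
  also have "\<dots> \<le> card (pverts G) ^ Suc k"
    using Suc by (simp add: card_cartesian_product)
  finally show ?case
    using fin by (simp only: eq finite_imageI)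
qed simp

text \<open>The left-hand side is at most the term \<open>k = 2\<close> of the supremum. That a term
  lies below the supremum rests on boundedness, which is established first.\<close>

lemma sqrt_independence_number_le_shannon_capacity:
  assumes "pair_graph G"
  shows "sqrt (real (independence_number (G \<boxtimes> G))) \<le> shannon_capacity G"
proof -
  interpret pair_graph G by fact
  let ?r = "\<lambda>k. root k (real (independence_number (strong_power G k)))"
  have "?r k \<le> real (card (pverts G))" if "k \<ge> 1" for k
  proof -
    have "independence_number (strong_power G k) \<le> card (pverts G) ^ k"
      using independence_number_le_card strong_power_verts[OF pair_finite_verts]
      by (meson order_trans)
    then have "real (independence_number (strong_power G k)) \<le> real (card (pverts G)) ^ k"
      by (metis of_nat_le_iff of_nat_power)
    then have "?r k \<le> root k (real (card (pverts G)) ^ k)"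
      using that by simp
    then show ?thesis
      using that by (simp add: real_root_power_cancel)
  qed
  then have "bdd_above (?r ` {1..})"
    by (intro bdd_aboveI2) auto
  then have "?r 2 \<le> shannon_capacity G"
    unfolding shannon_capacity_def by (intro cSUP_upper) auto
  moreover have "independence_number (G \<boxtimes> G) \<le> independence_number (strong_power G 2)"
    unfolding strong_power_2[OF assms]
    by (intro independence_number_image_graph_ge)
      (auto simp: strong_product_def inj_on_def pair_finite_verts)
  then have "sqrt (real (independence_number (G \<boxtimes> G))) \<le> ?r 2"
    by (simp add: sqrt_def)
  ultimately show ?thesis
    by linarith
qed

text \<open>For the indicator vector of \<open>S\<close> the squared norm is \<open>card S\<close>,
  while the form adds up \<open>(card S)^2\<close> entries of \<open>X\<close>, each at least 1
  because no two vertices of \<open>S\<close> are adjacent.\<close>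

lemma card_independent_set_le_lambda_max:
  assumes S: "independent_set G S" "finite S" "S \<noteq> {}"
    and e: "bij_betw e {..<card (pverts G)} (pverts G)"
    and X: "X \<in> theta'_feasible (adjacency_matrix G e)"
  shows "real (card S) \<le> lambda_max X"
proof -
  define n where "n = card (pverts G)"
  have Xc: "X \<in> carrier_mat n n" "transpose_mat X = X"
    using X by (auto simp: theta'_feasible_def adjacency_matrix_def n_def)
  have ge: "X $$ (i, j) \<ge> 1" if "i < n" "j < n" "(e i, e j) \<notin> parcs G" for i j
    using X that by (auto simp: theta'_feasible_def adjacency_matrix_def n_def)
  define I where "I = {i. i < n \<and> e i \<in> S}"
  define y :: "nat \<Rightarrow> real" where "y = indicator I"
  have finI: "finite I" and I: "I \<subseteq> {..<n}"
    by (auto simp: I_def)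
  have "bij_betw e I S"
    unfolding bij_betw_def
  proof
    show "inj_on e I"
      using e I by (auto simp: bij_betw_def n_def intro: inj_on_subset)
    have "S \<subseteq> e ` {..<n}"
      using e S(1) by (simp add: bij_betw_def n_def independent_set_def)
    then show "e ` I = S"
      by (auto simp: I_def)
  qed
  then have cI: "card I = card S"
    by (rule bij_betw_same_card)
  have "card I > 0"
    unfolding cI using S(2,3) by (simp add: card_gt_0_iff)
  then have n: "n > 0"
    using I by (auto simp: card_gt_0_iff)
  have nrm: "(\<Sum>i<n. (y i)\<^sup>2) = card I"
  proof -
    have "(\<Sum>i<n. (y i)\<^sup>2) = (\<Sum>i\<in>I. 1)"
      using I by (intro sum.mono_neutral_cong_right) (auto simp: y_def)
    then show ?thesis
      by simp
  qed
  have "real (card I) * real (card I) = (\<Sum>i\<in>I. \<Sum>j\<in>I. 1)"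
    by simp
  also have "\<dots> \<le> (\<Sum>i\<in>I. \<Sum>j\<in>I. X $$ (i, j))"
    using S(1) by (intro sum_mono ge) (auto simp: I_def independent_set_def)
  \<comment> \<open>The factors \<open>y i\<close> and \<open>y j\<close> are 1 on \<open>I\<close>
    and 0 elsewhere, so the sums extend to all indices one after the other.\<close>
  also have "\<dots> = (\<Sum>i<n. \<Sum>j\<in>I. X $$ (i, j) * y i)"
    using I finI by (intro sum.mono_neutral_cong_left) (auto simp: y_def)
  also have "\<dots> = quad_form X y"
    unfolding quad_form_def carrier_matD(1)[OF Xc(1)]
    using I by (intro sum.cong refl sum.mono_neutral_cong_left) (auto simp: y_def)
  also have "\<dots> \<le> lambda_max X * card I"
    using quad_form_le_lambda_max[OF Xc n, of y] nrm by simp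
  finally show ?thesis
    using \<open>card I > 0\<close> by (simp add: cI)
qed

section \<open>Hamming distance through characters, and Gram matrices\<close>

text \<open>A form of the distance that can be evaluated on concrete words.\<close>

lemma hamming_dist_eq_length_filter:
  assumes "length u = length v"
  shows "hamming_dist u v = length (filter (\<lambda>(a, b). a \<noteq> b) (zip u v))"
  unfolding length_filter_conv_card hamming_dist_def using assms
  by (intro arg_cong[of _ _ card]) auto

text \<open>The nontrivial character of the group of order 2.\<close>

definition bool_sign :: "bool \<Rightarrow> real" where
  "bool_sign b = (if b then -1 else 1)"

text \<open>The characters of weight 1: each coordinate contributes 1 on agreement and -1 on
  disagreement.\<close>

lemma sum_bool_sign_mult:
  assumes "length u = n" "length v = n"
  shows "(\<Sum>i<n. bool_sign (u ! i) * bool_sign (v ! i)) = real n - 2 * real (hamming_dist u v)"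
proof -
  let ?D = "{i. i < n \<and> u ! i \<noteq> v ! i}"
  have "(\<Sum>i<n. bool_sign (u ! i) * bool_sign (v ! i)) = (\<Sum>i<n. 1 - 2 * indicator ?D i)"
    by (intro sum.cong) (auto simp: bool_sign_def)
  also have "\<dots> = real n - 2 * (\<Sum>i<n. indicator ?D i)"
    by (simp add: sum_subtractf sum_distrib_left)
  also have "(\<Sum>i<n. indicator ?D i) = real (card ?D)"
    by (simp add: indicator_def of_bool_def sum.If_cases Int_def)
  finally show ?thesis
    using assms by (simp add: hamming_dist_def)
qed

text \<open>The character of full weight: each disagreement contributes one factor -1.\<close>

lemma prod_bool_sign_mult:
  assumes "length u = n" "length v = n"
  shows "(\<Prod>i<n. bool_sign (u ! i)) * (\<Prod>i<n. bool_sign (v ! i)) = (-1) ^ hamming_dist u v"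
proof -
  let ?D = "{i. i < n \<and> u ! i \<noteq> v ! i}"
  have "(\<Prod>i<n. bool_sign (u ! i)) * (\<Prod>i<n. bool_sign (v ! i))
      = (\<Prod>i<n. bool_sign (u ! i) * bool_sign (v ! i))"
    by (simp add: prod.distrib)
  also have "\<dots> = (\<Prod>i\<in>?D. - 1)"
    by (intro prod.mono_neutral_cong_right) (auto simp: bool_sign_def)
  finally show ?thesis
    using assms by (simp add: hamming_dist_def)
qed

text \<open>The subtracted part is a nonnegative multiple of a Gram matrix, whose quadratic form is
  a sum of squares.\<close>

lemma lambda_max_diagonal_minus_gram_le:
  assumes "n > 0" "d \<ge> 0"
  shows "lambda_max (mat n n (\<lambda>(i, j). (if i = j then c else 0) - d * (\<Sum>k<m. f k i * f k j))) \<le> c"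
    (is "lambda_max ?X \<le> c")
proof (rule lambda_max_le)
  show "?X \<in> carrier_mat n n" "n > 0"
    using assms by simp_all
  show "transpose_mat ?X = ?X"
    by (intro eq_matI) (auto simp: mult.commute)
next
  fix y
  have "quad_form ?X y = (\<Sum>i<n. \<Sum>j<n. (if i = j then c else 0) * y i * y j
      - d * (\<Sum>k<m. (f k i * y i) * (f k j * y j)))"
    unfolding quad_form_def dim_row_mat
    by (intro sum.cong refl)
      (auto simp: algebra_simps sum_distrib_left sum_distrib_right)
  also have "\<dots> = (\<Sum>i<n. \<Sum>j<n. (if i = j then c * (y i)\<^sup>2 else 0))
      - d * (\<Sum>i<n. \<Sum>j<n. \<Sum>k<m. (f k i * y i) * (f k j * y j))"
    unfolding sum_subtractf sum_distrib_left[symmetric]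
    by (intro arg_cong2[of _ _ _ _ "(-)"] sum.cong refl) (simp add: power2_eq_square)
  also have "(\<Sum>i<n. \<Sum>j<n. (if i = j then c * (y i)\<^sup>2 else 0)) = c * (\<Sum>i<n. (y i)\<^sup>2)"
    by (simp add: sum_distrib_left)
  \<comment> \<open>Two exchanges bring \<open>k\<close> to the outside, where each double sum
    factors as a square.\<close>
  also have "(\<Sum>i<n. \<Sum>j<n. \<Sum>k<m. (f k i * y i) * (f k j * y j))
      = (\<Sum>i<n. \<Sum>k<m. \<Sum>j<n. (f k i * y i) * (f k j * y j))"
    by (intro sum.cong refl sum.swap)
  also have "\<dots> = (\<Sum>k<m. \<Sum>i<n. \<Sum>j<n. (f k i * y i) * (f k j * y j))"
    by (rule sum.swap)
  also have "\<dots> = (\<Sum>k<m. (\<Sum>i<n. f k i * y i)\<^sup>2)"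
    by (simp only: power2_eq_square sum_product)
  finally show "quad_form ?X y \<le> c * (\<Sum>i<n. (y i)\<^sup>2)"
    using assms by (simp add: sum_nonneg)
qed

section \<open>The Hamming graph and its \<open>schrijver_theta'\<close> value\<close>

lemma pair_graph_hamming: "pair_graph hamming_graph_5_2"
proof
  show fin: "finite (pverts hamming_graph_5_2)"
    using finite_lists_length_eq[of "UNIV :: bool set" 5] by (simp add: hamming_graph_5_2_def)
  have "parcs hamming_graph_5_2 \<subseteq> pverts hamming_graph_5_2 \<times> pverts hamming_graph_5_2"
    by (auto simp: hamming_graph_5_2_def)
  then show "finite (parcs hamming_graph_5_2)"
    using fin finite_subset by blast
  have "hamming_dist v u = hamming_dist u v" if "length u = length v" for u v :: "bool list"
    using that by (simp add: hamming_dist_def eq_commute)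
  then show "symmetric hamming_graph_5_2"
    by (auto simp: symmetric_def hamming_graph_5_2_def sym_def)
qed (auto simp: hamming_graph_5_2_def hamming_dist_def)

lemma card_hamming_verts: "card (pverts hamming_graph_5_2) = 32"
  using card_lists_length_eq[of "UNIV :: bool set" 5] by (simp add: hamming_graph_5_2_def)

text \<open>The binary linear code spanned by 11100 and 00111, of minimum distance 3.\<close>

definition code_4 :: "bool list set" where
  "code_4 = {[False, False, False, False, False], [True, True, True, False, False],
     [False, False, True, True, True], [True, True, False, True, True]}"

lemma independent_code_4: "independent_set hamming_graph_5_2 code_4"
  by (simp add: independent_set_def hamming_graph_5_2_def code_4_def hamming_dist_eq_length_filter)

lemma card_code_4: "card code_4 = 4"
  by (simp add: code_4_def)

lemma schrijver_theta'_hamming: "schrijver_theta' hamming_graph_5_2 = 4"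
proof -
  let ?G = "hamming_graph_5_2"
  \<comment> \<open>The very enumeration chosen in \<open>schrijver_theta'\<close>.\<close>
  define e where "e = (SOME e. bij_betw e {..<card (pverts ?G)} (pverts ?G))"
  interpret pair_graph ?G by (rule pair_graph_hamming)
  have "\<exists>e. bij_betw e {..<card (pverts ?G)} (pverts ?G)"
    using ex_bij_betw_nat_finite[OF pair_finite_verts] by (simp add: lessThan_atLeast0)
  then have e: "bij_betw e {..<card (pverts ?G)} (pverts ?G)"
    unfolding e_def by (rule someI_ex)
  have len: "length (e i) = 5" if "i < 32" for i
    using bij_betwE[OF e] that unfolding card_hamming_verts by (simp add: hamming_graph_5_2_def)
  have ge: "4 \<le> lambda_max X" if "X \<in> theta'_feasible (adjacency_matrix ?G e)" for X
    using card_independent_set_le_lambda_max[OF independent_code_4 _ _ e that] card_code_4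
    by (simp add: code_4_def)
  \<comment> \<open>The six characters: indices 0 to 4 give the coordinates, and index 5 gives the
    character of weight 5.\<close>
  define f where "f k i = (if k < 5 then bool_sign (e i ! k) else \<Prod>l<5. bool_sign (e i ! l))"
    for k i
  define X where "X = mat 32 32
    (\<lambda>(i, j). (if i = j then 4 else 0) - 1 / 2 * (\<Sum>k<6. f k i * f k j))"
  have le: "lambda_max X \<le> 4"
    unfolding X_def by (rule lambda_max_diagonal_minus_gram_le) auto
  have gram: "(\<Sum>k<6. f k i * f k j)
      = 5 - 2 * real (hamming_dist (e i) (e j)) + (-1) ^ hamming_dist (e i) (e j)"
    if "i < 32" "j < 32" for i j
  proof -
    have "(\<Sum>k<6. f k i * f k j) = (\<Sum>k<5. f k i * f k j) + f 5 i * f 5 j"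
      using sum.lessThan_Suc[of "\<lambda>k. f k i * f k j" 5] by simp
    also have "(\<Sum>k<5. f k i * f k j) = (\<Sum>k<5. bool_sign (e i ! k) * bool_sign (e j ! k))"
      by (intro sum.cong) (auto simp: f_def)
    finally show ?thesis
      using sum_bool_sign_mult[OF len len, OF that] prod_bool_sign_mult[OF len len, OF that]
      by (simp add: f_def)
  qed
  have "X $$ (i, j) \<ge> 1" if ij: "i < 32" "j < 32" "(e i, e j) \<notin> parcs ?G" for i j
  \<comment> \<open>On the diagonal the Gram sum is 6, which leaves \<open>4 - 6 / 2 = 1\<close>.
    Off the diagonal, nonadjacent words have distance 3, 4 or 5 with Gram sums -2, -2 and -6, hence
    entries 1, 1 and 3.\<close>
  proof (cases "i = j")
    case True
    then show ?thesis
      using ij gram[of j j] by (simp add: X_def hamming_dist_def)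
  next
    case False
    let ?d = "hamming_dist (e i) (e j)"
    have "e i \<noteq> e j"
      using False e ij by (auto simp: bij_betw_def inj_on_def card_hamming_verts)
    then have "?d \<noteq> 0"
      using ij len by (auto simp: hamming_dist_def list_eq_iff_nth_eq)
    moreover have "?d \<le> 5"
      unfolding hamming_dist_def len[OF ij(1)]
      using card_mono[of "{..<5}" "{l. l < 5 \<and> e i ! l \<noteq> e j ! l}"] by auto
    ultimately have "?d \<in> {3, 4, 5}"
      using ij len by (auto simp: hamming_graph_5_2_def)
    then show ?thesis
      using False ij gram[of i j] by (auto simp: X_def)
  qed
  moreover have "transpose_mat X = X"
    unfolding X_def by (intro eq_matI) (auto simp: mult.commute)
  ultimately have feas: "X \<in> theta'_feasible (adjacency_matrix ?G e)"
    by (auto simp: theta'_feasible_def adjacency_matrix_def card_hamming_verts X_def)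
  have "(INF X\<in>theta'_feasible (adjacency_matrix ?G e). lambda_max X) = 4"
    using feas le ge by (intro cInf_eq_minimum) (auto intro!: image_eqI[of _ _ X] antisym)
  then show ?thesis
    by (simp add: schrijver_theta'_def Let_def flip: e_def)
qed

section \<open>An independent set of size 20 in the strong square\<close>

text \<open>A union of four orbits of the cyclic group of order 5 that shifts both components
  simultaneously.\<close>

definition code_20 :: "(bool list \<times> bool list) list" where
  "code_20 = [(rotate k u, rotate k v).
     (u, v) \<leftarrow> [([False, True, False, True, True], [False, True, True, False, False]),
       ([False, False, True, False, True], [True, True, True, False, False]),
       ([False, False, True, True, True], [False, True, False, True, True]),
       ([False, False, False, True, True], [True, False, False, True, False])],
     k \<leftarrow> [0, 1, 2, 3, 4]]"

lemma length_code_20: "length code_20 = 20"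
  unfolding code_20_def by simp

lemma distinct_code_20: "distinct code_20"
  unfolding code_20_def by code_simp

lemma length_code_20_words:
  "(u, v) \<in> set code_20 \<Longrightarrow> length u = 5 \<and> length v = 5"
  unfolding code_20_def by auto

text \<open>A finite check over all pairs of codewords, by evaluation. Distance above 2 in one
  component makes the two words there distinct and nonadjacent, which rules out adjacency in the
  strong product.\<close>

lemma code_20_far:
  "\<forall>p\<in>set code_20. \<forall>q\<in>set code_20. p = q
    \<or> 2 < length (filter (\<lambda>(a, b). a \<noteq> b) (zip (fst p) (fst q)))
    \<or> 2 < length (filter (\<lambda>(a, b). a \<noteq> b) (zip (snd p) (snd q)))"
  unfolding code_20_def by code_simp

lemma independence_number_hamming_squared_ge:
  "20 \<le> independence_number (hamming_graph_5_2 \<boxtimes> hamming_graph_5_2)"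
proof -
  let ?G = hamming_graph_5_2
  interpret pair_graph ?G by (rule pair_graph_hamming)
  have len: "length u = 5" "length v = 5" if "(u, v) \<in> set code_20" for u v
    using length_code_20_words that by auto
  have dist: "hamming_dist u u' > 2 \<or> hamming_dist v v' > 2"
    if "(u, v) \<in> set code_20" "(u', v') \<in> set code_20" "(u, v) \<noteq> (u', v')" for u v u' v'
    using bspec[OF bspec[OF code_20_far that(1)] that(2)] that(3)
    by (auto simp: hamming_dist_eq_length_filter len[OF that(1)] len[OF that(2)])
  have "independent_set (?G \<boxtimes> ?G) (set code_20)"
    unfolding independent_set_def
  proof (intro conjI ballI)
    show "set code_20 \<subseteq> pverts (?G \<boxtimes> ?G)"
      using len by (auto simp: strong_product_def hamming_graph_5_2_def)
  next
    fix p q assume pq: "p \<in> set code_20" "q \<in> set code_20"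
    show "(p, q) \<notin> parcs (?G \<boxtimes> ?G)"
    proof (cases "p = q")
      case False
      have "hamming_dist (fst p) (fst q) > 2 \<or> hamming_dist (snd p) (snd q) > 2"
        using pq False by (intro dist) auto
      \<comment> \<open>Covers the arcs with one equal component: every arc of the product has
        distance at most 2 in both components.\<close>
      moreover have "hamming_dist u u = 0" for u :: "bool list"
        by (simp add: hamming_dist_def)
      ultimately show ?thesis
        using False by (auto simp: strong_product_def hamming_graph_5_2_def)
    qed (simp add: strong_product_def)
  qed
  then have "card (set code_20) \<le> independence_number (?G \<boxtimes> ?G)"
    by (intro card_le_independence_number) (auto simp: strong_product_def pair_finite_verts)
  then show ?thesis
    using distinct_code_20 length_code_20 by (simp add: distinct_card)
qed

theorem mainTheorem1:
  fixes G :: "bool list pair_pre_digraph"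
  assumes G_def: "G = hamming_graph_5_2"
  shows "pair_graph G \<and> card (pverts G) = 32
    \<and> shannon_capacity G \<ge> sqrt (real (independence_number (G \<boxtimes> G)))
    \<and> sqrt (real (independence_number (G \<boxtimes> G))) \<ge> sqrt 20
    \<and> sqrt 20 > (4 :: real)
    \<and> schrijver_theta' G = 4
    \<and> \<not> shannon_capacity G \<le> schrijver_theta' G
    \<and> \<not> (\<forall>H :: bool list pair_pre_digraph.
            pair_graph H \<and> pverts H \<noteq> {} \<longrightarrow> shannon_capacity H \<le> schrijver_theta' H)"
proof -
  have graph: "pair_graph G" and card: "card (pverts G) = 32" and theta: "schrijver_theta' G = 4"
    unfolding G_def
    by (rule pair_graph_hamming card_hamming_verts schrijver_theta'_hamming)+
  have cap: "sqrt (real (independence_number (G \<boxtimes> G))) \<le> shannon_capacity G"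
    using graph by (rule sqrt_independence_number_le_shannon_capacity)
  have alpha: "sqrt 20 \<le> sqrt (real (independence_number (G \<boxtimes> G)))"
    using independence_number_hamming_squared_ge by (simp add: G_def)
  have four: "(4 :: real) < sqrt 20"
    by (rule real_less_rsqrt) simp
  have gt: "\<not> shannon_capacity G \<le> schrijver_theta' G"
    using cap alpha four theta by linarith
  \<comment> \<open>Makes \<open>G\<close> an admissible instance of the universal claim that is
    refuted.\<close>
  have "pverts G \<noteq> {}"
    using card by auto
  with graph card cap alpha four theta gt show ?thesis
    by blast
qed

end
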